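(* For every $n\ge 1$ and every $f:\{0,1\}^n\to\{0,1\}$, $\mathrm{EC}(f)\le C(f)$.
   Context: Let $f:\{0,1\}^n\to\{0,1\}$ and $[n]=\{1,\dots,n\}$. Certificate complexity: an assignment is a map $A:[n]\to\{0,1,*\}$, identified with the subcube $\{x: \forall i,\ x_i=A(i)\text{ or }A(i)=*\}$; its size is $|A|=|\{i:A(i)\ne *\}|$. A $b$-certificate for $f$ is an assignment $A$ such that $x\in A\Rightarrow f(x)=b$. $C(f,x)$ is the size of the smallest $f(x)$-certificate consistent with $x$ (i.e. with $x\in A$), and $C(f)=\max_x C(f,x)$. The expectational certificate complexity $\mathrm{EC}(f)$ is the optimal value of the following program over families $\{w_x\}_{x\in\{0,1\}^n}$, $w_x\in\mathbb R^n$: minimize $\max_{x}\sum_{i=1}^n w_x(i)$ subject to $\sum_{i:x_i\ne y_i} w_x(i)w_y(i)\ge 1$ for all $x,y$ with $f(x)\ne f(y)$, and $0\le w_x(i)\le 1$ for all $x\in\{0,1\}^n$, $i\in[n]$. *)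

theory Defs
  imports "HOL-Analysis.Analysis"
begin

text \<open>
  The Boolean cube is \<^typ>\<open>bool^'n\<close>, with \<^term>\<open>False\<close> and \<^term>\<open>True\<close> for 0 and 1; the finite
  (and nonempty) index type \<^typ>\<open>'n\<close> plays the role of $[n]$. The star of a partial assignment is
  \<^term>\<open>None\<close>.
\<close>

type_synonym 'n assignment = "'n \<Rightarrow> bool option"

definition subcube :: "'n::finite assignment \<Rightarrow> (bool^'n) set" where
  "subcube A = {x. \<forall>i. A i = Some (x $ i) \<or> A i = None}"

definition assignment_size :: "'n::finite assignment \<Rightarrow> nat" where
  "assignment_size A = card {i. A i \<noteq> None}"

definition certificate :: "(bool^'n::finite \<Rightarrow> bool) \<Rightarrow> bool \<Rightarrow> 'n assignment \<Rightarrow> bool" where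
  "certificate f b A \<longleftrightarrow> (\<forall>x\<in>subcube A. f x = b)"

definition cert_complexity_at :: "(bool^'n::finite \<Rightarrow> bool) \<Rightarrow> bool^'n \<Rightarrow> nat" where
  "cert_complexity_at f x = Min (assignment_size ` {A. certificate f (f x) A \<and> x \<in> subcube A})"

definition cert_complexity :: "(bool^'n::finite \<Rightarrow> bool) \<Rightarrow> nat" where
  "cert_complexity f = Max (range (cert_complexity_at f))"

definition EC_feasible :: "(bool^'n::finite \<Rightarrow> bool) \<Rightarrow> (bool^'n \<Rightarrow> real^'n) \<Rightarrow> bool" where
  "EC_feasible f w \<longleftrightarrow>
     (\<forall>x y. f x \<noteq> f y \<longrightarrow> (\<Sum>i | x $ i \<noteq> y $ i. w x $ i * w y $ i) \<ge> 1) \<and>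
     (\<forall>x i. 0 \<le> w x $ i \<and> w x $ i \<le> 1)"

definition EC_value :: "(bool^'n::finite \<Rightarrow> real^'n) \<Rightarrow> real" where
  "EC_value w = Max (range (\<lambda>x. \<Sum>i\<in>UNIV. w x $ i))"

definition EC :: "(bool^'n::finite \<Rightarrow> bool) \<Rightarrow> real" where
  "EC f = Inf (EC_value ` {w. EC_feasible f w})"

text \<open>The minima and the infimum above are taken over nonempty sets that are bounded below.\<close>

lemma cert_exists: "{A. certificate f (f x) A \<and> x \<in> subcube A} \<noteq> {}"
proof -
  have "subcube (\<lambda>i. Some (x $ i)) = {x}"
    by (auto simp: subcube_def vec_eq_iff)
  then have "certificate f (f x) (\<lambda>i. Some (x $ i)) \<and> x \<in> subcube (\<lambda>i. Some (x $ i))"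
    by (simp add: certificate_def)
  then show ?thesis by blast
qed

lemma EC_feasible_exists: "EC_feasible f (\<lambda>_. \<chi> i. 1)"
proof -
  have "(1::real) \<le> card {i. x $ i \<noteq> y $ i}" if "f x \<noteq> f y" for x y
  proof -
    have "x \<noteq> y" using that by auto
    then have "{i. x $ i \<noteq> y $ i} \<noteq> {}" by (auto simp: vec_eq_iff)
    then have "card {i. x $ i \<noteq> y $ i} > 0" by (simp add: card_gt_0_iff)
    then show ?thesis by linarith
  qed
  then show ?thesis by (simp add: EC_feasible_def)
qed

lemma EC_value_nonneg: "EC_feasible f w \<Longrightarrow> 0 \<le> EC_value w"
  unfolding EC_value_def
  by (subst Max_ge_iff) (auto simp: EC_feasible_def intro!: sum_nonneg)

lemma EC_values_bdd_below: "bdd_below (EC_value ` {w. EC_feasible f w})"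
  by (rule bdd_belowI[of _ 0]) (auto intro: EC_value_nonneg)

end

theory Submission
  imports Defs
begin

text \<open>
  Take for \<open>w x\<close> the indicator of the set of indices fixed by a minimal certificate of \<open>x\<close>.
  Certificates of inputs with different values are disjoint subcubes, so some index is fixed by both
  of them, to different values; this index contributes 1 to the sum for the pair.
\<close>

text \<open>If \<open>A\<close> and \<open>B\<close> demanded different values at no index, they
  could be glued to a point lying in both subcubes, where \<open>f\<close> would have to take both
  values \<open>f x\<close> and \<open>f y\<close>.\<close>

lemma certificates_conflict:
  fixes f :: "bool^'n::finite \<Rightarrow> bool"
  assumes "certificate f (f x) A" "x \<in> subcube A" "certificate f (f y) B" "y \<in> subcube B"
    and "f x \<noteq> f y"
  shows "\<exists>i. A i \<noteq> None \<and> B i \<noteq> None \<and> x $ i \<noteq> y $ i"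
proof (rule ccontr)
  assume "\<not> ?thesis"
  then have agree: "x $ i = y $ i" if "A i \<noteq> None" "B i \<noteq> None" for i
    using that by blast
  \<comment> \<open>The glued point follows \<open>x\<close> on the indices fixed by
    \<open>A\<close> and \<open>y\<close> elsewhere. It also respects \<open>B\<close>, because
    \<open>x\<close> and \<open>y\<close> agree wherever both assignments are fixed.\<close>
  define z :: "bool^'n" where "z = (\<chi> i. if A i \<noteq> None then x $ i else y $ i)"
  have "z \<in> subcube A"
    using assms(2) by (auto simp: subcube_def z_def)
  moreover have "z \<in> subcube B"
    unfolding subcube_def
  proof (intro CollectI allI)
    fix i
    have "B i = Some (y $ i) \<or> B i = None"
      using assms(4) by (simp add: subcube_def)
    then show "B i = Some (z $ i) \<or> B i = None"
      using agree[of i] by (auto simp: z_def)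
  qed
  ultimately show False
    using assms(1,3,5) unfolding certificate_def by blast
qed

lemma minimal_certificate:
  fixes f :: "bool^'n::finite \<Rightarrow> bool"
  obtains A where "certificate f (f x) A" "x \<in> subcube A"
    "assignment_size A = cert_complexity_at f x"
proof -
  have "cert_complexity_at f x \<in> assignment_size ` {A. certificate f (f x) A \<and> x \<in> subcube A}"
    unfolding cert_complexity_at_def using cert_exists[of f x] by (intro Min_in) auto
  then show thesis
    using that by auto
qed

theorem lemma10:
  fixes f :: "bool^'n::finite \<Rightarrow> bool"
  shows "EC f \<le> real (cert_complexity f)"
proof -
  have "\<forall>x. \<exists>A. certificate f (f x) A \<and> x \<in> subcube A \<and>
      assignment_size A = cert_complexity_at f x"
    by (metis minimal_certificate)
  then obtain A where A: "\<And>x. certificate f (f x) (A x)" "\<And>x. x \<in> subcube (A x)"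
    "\<And>x. assignment_size (A x) = cert_complexity_at f x"
    by metis
  define w :: "bool^'n \<Rightarrow> real^'n" where "w x = (\<chi> i. of_bool (A x i \<noteq> None))" for x
  have "1 \<le> (\<Sum>i | x $ i \<noteq> y $ i. w x $ i * w y $ i)" if neq: "f x \<noteq> f y" for x y
  proof -
    obtain i where i: "A x i \<noteq> None" "A y i \<noteq> None" "x $ i \<noteq> y $ i"
      using certificates_conflict[OF A(1,2) A(1,2) neq] by blast
    then have "1 = w x $ i * w y $ i"
      by (simp add: w_def)
    \<comment> \<open>All terms are products of 0/1 weights, so the single term at \<open>i\<close>
      is a lower bound for the sum.\<close>
    also have "\<dots> \<le> (\<Sum>i | x $ i \<noteq> y $ i. w x $ i * w y $ i)"
      using i(3) by (intro member_le_sum) (auto simp: w_def)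
    finally show ?thesis .
  qed
  then have "EC_feasible f w"
    by (simp add: EC_feasible_def w_def)
  \<comment> \<open>A real infimum lies below each member of a set that is bounded below; here 0 is
    a bound.\<close>
  then have "EC f \<le> EC_value w"
    unfolding EC_def by (intro cInf_lower EC_values_bdd_below) simp
  also have "EC_value w \<le> real (cert_complexity f)"
  proof -
    \<comment> \<open>The 0/1 weights count the indices fixed by \<open>A x\<close>, and
      \<open>A x\<close> was chosen of minimal size.\<close>
    have "(\<Sum>i\<in>UNIV. w x $ i) = real (cert_complexity_at f x)" for x
      by (simp add: w_def A(3)[symmetric] assignment_size_def)
    then show ?thesis
      by (simp add: EC_value_def cert_complexity_def)
  qed
  finally show ?thesis .
qed

end
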